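(* Let $G$ be a connected $\{K_4,K_4-e\}$-free graph. Then $\gamma_{r2}(G)=2\gamma_r(G)$ if and only if one of the following holds: (i) $G$ is $K_2$; or (ii) $G$ arises by adding a matching containing two edges between two disjoint triangles; or (iii) $G$ arises from the disjoint union of $k=\gamma_r(G)$ triangles $v_1w_1u_1v_1$, $v_2w_2u_2v_2$, $\ldots$, $v_kw_ku_kv_k$ by adding edges between the vertices in $\{v_1,\ldots,v_k\}$.
   Context: All graphs are finite, simple, and undirected. $N_G(u)$ denotes the set of neighbors of $u$ in $G$. $K_n$ is the complete graph of order $n$, and $K_n-e$ arises from $K_n$ by removing one edge. A graph is $\{K_4,K_4-e\}$-free if it has no induced subgraph isomorphic to $K_4$ or to $K_4-e$. Graphs are described up to isomorphism. In (ii), the two added edges each join a vertex of one triangle to a vertex of the other and share no endpoint. In (iii), an arbitrary (possibly empty) set of edges joining pairs of vertices of $\{v_1,\ldots,v_k\}$ is added and no other edges are added. A $2$-rainbow dominating function of a graph $G$ is a function $f:V(G)\to 2^{\{1,2\}}$ (values are subsets of $\{1,2\}$) such that $\bigcup_{v\in N_G(u)}f(v)=\{1,2\}$ for every vertex $u$ of $G$ with $f(u)=\emptyset$. Its weight is $\sum_{u\in V(G)}|f(u)|$. The $2$-rainbow domination number $\gamma_{r2}(G)$ is the minimum weight of a $2$-rainbow dominating function of $G$. A set $D$ of vertices of $G$ is dominating if every vertex in $V(G)\setminus D$ has a neighbor in $D$. For a function $g:V(G)\to\mathbb{R}$ and two distinct vertices $u,v$ of $G$, let $g_{v\to u}:V(G)\to\mathbb{R}$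 be the function with $g_{v\to u}(u)=g(u)+1$, $g_{v\to u}(v)=g(v)-1$, and $g_{v\to u}(x)=g(x)$ for $x\in V(G)\setminus\{u,v\}$. A weak Roman dominating function of $G$ is a function $g:V(G)\to\{0,1,2\}$ such that every vertex $u$ of $G$ with $g(u)=0$ has a neighbor $v$ with $g(v)\geq 1$ such that the set $\{x\in V(G): g_{v\to u}(x)\geq 1\}$ is dominating. Its weight is $\sum_{u\in V(G)}g(u)$. The weak Roman domination number $\gamma_r(G)$ is the minimum weight of a weak Roman dominating function of $G$. *)

theory Defs
  imports Complex_Main "Graph_Theory.Graph_Theory"
begin

text \<open>
  Finite simple undirected graphs are the symmetric, loop-free digraphs without parallel arcs of
  the locale \<^locale>\<open>graph\<close>; the edge \<open>uv\<close> is the pair of arcs from \<open>u\<close> to \<open>v\<close> and from \<open>v\<close> to \<open>u\<close>.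
\<close>

definition neighbors :: "('a, 'b) pre_digraph \<Rightarrow> 'a \<Rightarrow> 'a set" where
  "neighbors G u = {v. u \<rightarrow>\<^bsub>G\<^esub> v}"

definition all_pairs :: "'a set \<Rightarrow> ('a \<times> 'a) set" where
  "all_pairs A = {(x, y). x \<in> A \<and> y \<in> A \<and> x \<noteq> y}"

definition complete_minus_edge :: "nat \<Rightarrow> ('a, 'b) pre_digraph \<Rightarrow> bool" where
  "complete_minus_edge n G \<longleftrightarrow> graph G \<and> card (verts G) = n \<and>
     (\<exists>a \<in> verts G. \<exists>b \<in> verts G. a \<noteq> b \<and>
        arcs_ends G = all_pairs (verts G) - {(a, b), (b, a)})"

text \<open>
  The predicates \<^const>\<open>complete_digraph\<close> and \<^const>\<open>complete_minus_edge\<close> are invariant under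
  isomorphism, so no explicit isomorphism is needed below.
\<close>

definition K4_diamond_free :: "('a, 'b) pre_digraph \<Rightarrow> bool" where
  "K4_diamond_free G \<longleftrightarrow>
     \<not> (\<exists>H. induced_subgraph H G \<and> (complete_digraph 4 H \<or> complete_minus_edge 4 H))"

text \<open>
  Vertex functions are total on the type \<open>'a\<close>; only their values on \<^term>\<open>verts G\<close> matter.
\<close>

definition rainbow2_dominating :: "('a, 'b) pre_digraph \<Rightarrow> ('a \<Rightarrow> nat set) \<Rightarrow> bool" where
  "rainbow2_dominating G f \<longleftrightarrow>
     (\<forall>u \<in> verts G. f u \<subseteq> {1, 2}) \<and>
     (\<forall>u \<in> verts G. f u = {} \<longrightarrow> (\<Union>v \<in> neighbors G u. f v) = {1, 2})"

definition rainbow2_domination_number :: "('a, 'b) pre_digraph \<Rightarrow> nat" where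
  "rainbow2_domination_number G =
     (LEAST n. \<exists>f. rainbow2_dominating G f \<and> n = (\<Sum>u \<in> verts G. card (f u)))"

definition dominating_set :: "('a, 'b) pre_digraph \<Rightarrow> 'a set \<Rightarrow> bool" where
  "dominating_set G D \<longleftrightarrow>
     D \<subseteq> verts G \<and> (\<forall>u \<in> verts G - D. neighbors G u \<inter> D \<noteq> {})"

text \<open>\<open>move_unit g v u\<close> is $g_{v \to u}$; it is used for \<open>u \<noteq> v\<close> only.\<close>

definition move_unit :: "('a \<Rightarrow> real) \<Rightarrow> 'a \<Rightarrow> 'a \<Rightarrow> 'a \<Rightarrow> real" where
  "move_unit g v u = g(u := g u + 1, v := g v - 1)"

definition weak_roman_dominating :: "('a, 'b) pre_digraph \<Rightarrow> ('a \<Rightarrow> nat) \<Rightarrow> bool" where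
  "weak_roman_dominating G g \<longleftrightarrow>
     (\<forall>u \<in> verts G. g u \<in> {0, 1, 2}) \<and>
     (\<forall>u \<in> verts G. g u = 0 \<longrightarrow>
        (\<exists>v \<in> neighbors G u. g v \<ge> 1 \<and>
           dominating_set G {x \<in> verts G. move_unit (\<lambda>y. real (g y)) v u x \<ge> 1}))"

definition weak_roman_domination_number :: "('a, 'b) pre_digraph \<Rightarrow> nat" where
  "weak_roman_domination_number G =
     (LEAST n. \<exists>g. weak_roman_dominating G g \<and> n = (\<Sum>u \<in> verts G. g u))"

text \<open>
  In the next two definitions the arcs are described by their end points. The matching \<open>M\<close> lists
  each of its edges once, directed from \<open>A\<close> to \<open>B\<close>; injectivity of both projections says that its
  edges share no end point.
\<close>

definition two_triangles_with_matching :: "('a, 'b) pre_digraph \<Rightarrow> bool" where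
  "two_triangles_with_matching G \<longleftrightarrow>
     (\<exists>A B M. card A = 3 \<and> card B = 3 \<and> A \<inter> B = {} \<and> verts G = A \<union> B \<and>
        M \<subseteq> A \<times> B \<and> card M = 2 \<and> inj_on fst M \<and> inj_on snd M \<and>
        arcs_ends G = all_pairs A \<union> all_pairs B \<union> M \<union> M\<inverse>)"

definition triangles_joined_at_vertices :: "nat \<Rightarrow> ('a, 'b) pre_digraph \<Rightarrow> bool" where
  "triangles_joined_at_vertices k G \<longleftrightarrow>
     (\<exists>v w u F.
        (\<forall>i \<in> {1..k}. distinct [v i, w i, u i]) \<and>
        (\<forall>i \<in> {1..k}. \<forall>j \<in> {1..k}. i \<noteq> j \<longrightarrow> {v i, w i, u i} \<inter> {v j, w j, u j} = {}) \<and>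
        verts G = (\<Union>i \<in> {1..k}. {v i, w i, u i}) \<and>
        F \<subseteq> all_pairs (v ` {1..k}) \<and> sym F \<and>
        arcs_ends G = (\<Union>i \<in> {1..k}. all_pairs {v i, w i, u i}) \<union> F)"

end

theory Submission
  imports Defs "HOL-Library.Disjoint_Sets"
begin

text \<open>
  Write \<open>\<gamma>\<^sub>r\<^sub>2\<close> and \<open>\<gamma>\<^sub>r\<close> for the two domination numbers. Labelling every vertex of a dominating
  set \<open>D\<close> with \<open>{1, 2}\<close> costs \<open>2 |D|\<close>, and the support of a weak Roman dominating function
  dominates, so \<open>\<gamma>\<^sub>r\<^sub>2 \<le> 2 \<gamma>\<^sub>r\<close> always. If equality holds, there is no slack anywhere: an optimal
  weak Roman dominating function is the indicator of a set \<open>D\<close> with \<open>\<gamma>\<^sub>r\<close> elements, and every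
  vertex \<open>u\<close> outside \<open>D\<close> has a defender \<open>v \<in> D\<close>, a neighbour such that \<open>D - v + u\<close> still
  dominates.

  The main step (\<open>clique_partition_if_extremal\<close>) is that the sets consisting of a \<open>v \<in> D\<close> and the
  vertices it defends are cliques with two or three vertices. The reason is that each \<open>v \<in> D\<close> has
  a private neighbour \<open>p\<close>, whose only neighbour in \<open>D\<close> is \<open>v\<close>: otherwise \<open>D - v\<close> dominates
  everything except \<open>v\<close>, and a single further colour on \<open>v\<close> gives weight \<open>2 \<gamma>\<^sub>r - 1\<close>. When \<open>v\<close>
  moves to a vertex \<open>u\<close> that it defends, \<open>p\<close> must still be dominated, so \<open>u\<close> is \<open>p\<close> or a common
  neighbour of \<open>v\<close> and \<open>p\<close>; and without \<open>K\<^sub>4\<close> and \<open>K\<^sub>4 - e\<close> two adjacent vertices have at most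
  one common neighbour.

  In a partition into \<open>\<gamma>\<^sub>r\<close> cliques, any transversal dominates, so representatives can be chosen
  freely. If representatives of the other blocks can be chosen to dominate all but one vertex of a
  block, a rainbow function of weight \<open>2 \<gamma>\<^sub>r - 1\<close> results (\<open>no_two_exits\<close>). Hence a block of size
  two has no edge leaving it and is the whole graph, and if two vertices of a triangle have
  neighbours outside, all edges leaving this triangle end in one and the same other triangle. The
  latter case gives two triangles joined by two or three independent edges, and the prism, with
  three of them, has a rainbow function of weight 3. In the remaining case each triangle has at
  most one vertex with neighbours outside.

  Conversely, a partition into \<open>k\<close> cliques gives \<open>\<gamma>\<^sub>r \<le> k\<close>, so by \<open>\<gamma>\<^sub>r\<^sub>2 \<le> 2 \<gamma>\<^sub>r\<close> it suffices to see
  \<open>\<gamma>\<^sub>r\<^sub>2 \<ge> 2 k\<close> in each family, which is a count of the colours within each block.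
\<close>

section \<open>Rainbow domination through colour classes\<close>

(* Frees the arrow, which otherwise also denotes the set of functions between two sets, for adjacency. *)
no_notation FuncSet.funcset (infixr \<open>\<rightarrow>\<close> 60)

text \<open>
  A function \<open>f\<close> into the subsets of \<open>{1, 2}\<close> is the same as the pair of its colour classes
  \<open>X = {u. 1 \<in> f u}\<close> and \<open>Y = {u. 2 \<in> f u}\<close>, and its weight is \<open>|X| + |Y|\<close>. In this form rainbow
  domination is a condition on neighbours only, and the weight can be counted block by block.
\<close>

definition colour_classes :: "('a, 'b) pre_digraph \<Rightarrow> 'a set \<Rightarrow> 'a set \<Rightarrow> bool" where
  "colour_classes G X Y \<longleftrightarrow> X \<subseteq> verts G \<and> Y \<subseteq> verts G \<and>
     (\<forall>u \<in> verts G - (X \<union> Y). (\<exists>x \<in> X. u \<rightarrow>\<^bsub>G\<^esub> x) \<and> (\<exists>y \<in> Y. u \<rightarrow>\<^bsub>G\<^esub> y))"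

text \<open>
  These are the supports of the weak Roman dominating functions with values in \<open>{0, 1}\<close>.
\<close>

definition secure_set :: "('a, 'b) pre_digraph \<Rightarrow> 'a set \<Rightarrow> bool" where
  "secure_set G D \<longleftrightarrow> D \<subseteq> verts G \<and>
     (\<forall>u \<in> verts G - D. \<exists>v \<in> D. u \<rightarrow>\<^bsub>G\<^esub> v \<and> dominating_set G (insert u (D - {v})))"

definition clique_partition :: "('a, 'b) pre_digraph \<Rightarrow> 'a set set \<Rightarrow> bool" where
  "clique_partition G \<C> \<longleftrightarrow> partition_on (verts G) \<C> \<and>
     (\<forall>C \<in> \<C>. \<forall>x \<in> C. \<forall>y \<in> C. x \<noteq> y \<longrightarrow> x \<rightarrow>\<^bsub>G\<^esub> y)"

context graph
begin

lemma adj_sym: "u \<rightarrow> v \<Longrightarrow> v \<rightarrow> u"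
  using sym_arcs by (auto simp: symmetric_def dest: symD)

lemma adj_neq: "u \<rightarrow> v \<Longrightarrow> u \<noteq> v"
  using no_loops by (auto simp: arcs_ends_conv)

lemma adj_verts: "u \<rightarrow> v \<Longrightarrow> u \<in> verts G \<and> v \<in> verts G"
  by (auto simp: arcs_ends_conv)

lemma rainbow2_le_colour_classes:
  assumes "colour_classes G X Y"
  shows "rainbow2_domination_number G \<le> card X + card Y"
proof -
  define f :: "'a \<Rightarrow> nat set"
    where "f u = (if u \<in> X then {1} else {}) \<union> (if u \<in> Y then {2} else {})" for u
  have sub: "X \<subseteq> verts G" "Y \<subseteq> verts G"
    using assms by (auto simp: colour_classes_def)
  have "rainbow2_dominating G f"
    unfolding rainbow2_dominating_def
  proof (intro conjI ballI impI)
    fix u assume u: "u \<in> verts G" "f u = {}"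
    then have "u \<in> verts G - (X \<union> Y)"
      by (auto simp: f_def split: if_splits)
    then obtain x y where xy: "x \<in> X" "u \<rightarrow> x" "y \<in> Y" "u \<rightarrow> y"
      using assms unfolding colour_classes_def by blast
    then have "x \<in> neighbors G u" "1 \<in> f x" "y \<in> neighbors G u" "2 \<in> f y"
      by (auto simp: neighbors_def f_def)
    moreover have "f v \<subseteq> {1, 2}" for v
      by (auto simp: f_def)
    ultimately show "(\<Union>v\<in>neighbors G u. f v) = {1, 2}"
      by blast
  qed (auto simp: f_def)
  moreover have "(\<Sum>u\<in>verts G. card (f u)) = card X + card Y"
  proof -
    have "card (f u) = (if u \<in> X then 1 else 0) + (if u \<in> Y then 1 else 0)" for u
      by (auto simp: f_def)
    then have "(\<Sum>u\<in>verts G. card (f u)) =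
        (\<Sum>u\<in>verts G. if u \<in> X then 1 else 0) + (\<Sum>u\<in>verts G. if u \<in> Y then 1 else 0)"
      by (simp add: sum.distrib)
    also have "\<dots> = card (verts G \<inter> X) + card (verts G \<inter> Y)"
      by (simp add: sum.If_cases Int_def)
    finally show ?thesis
      using sub by (simp add: Int_absorb1)
  qed
  ultimately show ?thesis
    unfolding rainbow2_domination_number_def by (intro Least_le) metis
qed

lemma colour_classes_attained:
  obtains X Y where "colour_classes G X Y" "rainbow2_domination_number G = card X + card Y"
proof -
  let ?P = "\<lambda>n. \<exists>f. rainbow2_dominating G f \<and> n = (\<Sum>u\<in>verts G. card (f u))"
  have "rainbow2_dominating G (\<lambda>_. {1})"
    by (auto simp: rainbow2_dominating_def)
  then have "\<exists>n. ?P n"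
    by (intro exI conjI) (assumption, rule refl)
  then have "?P (LEAST n. ?P n)"
    by (rule LeastI_ex)
  then obtain f where f: "rainbow2_dominating G f"
    "rainbow2_domination_number G = (\<Sum>u\<in>verts G. card (f u))"
    unfolding rainbow2_domination_number_def by (elim exE conjE)
  define X where "X = {u \<in> verts G. 1 \<in> f u}"
  define Y where "Y = {u \<in> verts G. 2 \<in> f u}"
  have sub: "f u \<subseteq> {1, 2}" if "u \<in> verts G" for u
    using f that by (auto simp: rainbow2_dominating_def)
  have "colour_classes G X Y"
    unfolding colour_classes_def
  proof (intro conjI ballI)
    fix u assume u: "u \<in> verts G - (X \<union> Y)"
    then have "f u = {}"
      using sub[of u] by (auto simp: X_def Y_def)
    then have *: "(\<Union>v\<in>neighbors G u. f v) = {1, 2}"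
      using f u by (auto simp: rainbow2_dominating_def)
    then have "1 \<in> (\<Union>v\<in>neighbors G u. f v)" "2 \<in> (\<Union>v\<in>neighbors G u. f v)"
      by auto
    then show "\<exists>x\<in>X. u \<rightarrow> x" "\<exists>y\<in>Y. u \<rightarrow> y"
      by (auto simp: X_def Y_def neighbors_def dest: adj_verts)
  qed (auto simp: X_def Y_def)
  moreover have "(\<Sum>u\<in>verts G. card (f u)) = card X + card Y"
  proof -
    have "card (f u) = (if 1 \<in> f u then 1 else 0) + (if 2 \<in> f u then 1 else 0)"
      if "u \<in> verts G" for u
    proof -
      have "f u = (if 1 \<in> f u then {1} else {}) \<union> (if 2 \<in> f u then {2} else {})"
        using sub[OF that] by auto
      then have "card (f u) =
          card ((if 1 \<in> f u then {1} else {}) \<union> (if 2 \<in> f u then {2::nat} else {}))"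
        by (rule arg_cong)
      then show ?thesis by simp
    qed
    then have "(\<Sum>u\<in>verts G. card (f u)) =
        (\<Sum>u\<in>verts G. if 1 \<in> f u then 1 else 0) + (\<Sum>u\<in>verts G. if 2 \<in> f u then 1 else 0)"
      by (simp add: sum.distrib)
    also have "\<dots> = card X + card Y"
      by (simp add: sum.If_cases X_def Y_def Int_def)
    finally show ?thesis .
  qed
  ultimately show ?thesis
    using that f(2) by simp
qed

lemma rainbow2_le_dominating:
  assumes "dominating_set G D"
  shows "rainbow2_domination_number G \<le> 2 * card D"
proof -
  have "colour_classes G D D"
    using assms by (auto simp: dominating_set_def colour_classes_def neighbors_def)
  from rainbow2_le_colour_classes[OF this] show ?thesis by simp
qed

text \<open>
  A set that dominates all vertices but one is almost as good as a dominating set: one colour on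
  the exceptional vertex \<open>c\<close> is enough, since only vertices with the empty label have to see both
  colours. Under extremality this rules out such sets with fewer than \<open>\<gamma>\<^sub>r\<close> elements.
\<close>

lemma rainbow2_le_almost_dominating:
  assumes "T \<subseteq> verts G" "c \<in> verts G"
    and "\<And>u. u \<in> verts G - T \<Longrightarrow> u \<noteq> c \<Longrightarrow> \<exists>t \<in> T. u \<rightarrow> t"
  shows "rainbow2_domination_number G \<le> 2 * card T + 1"
proof -
  have "colour_classes G (insert c T) T"
    using assms by (auto simp: colour_classes_def)
  from rainbow2_le_colour_classes[OF this]
  have "rainbow2_domination_number G \<le> card (insert c T) + card T" .
  moreover have "card (insert c T) \<le> card T + 1"
    using finite_subset[OF assms(1)] by (simp add: card_insert_if)
  ultimately show ?thesis by simp
qed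

section \<open>Weak Roman domination through secure sets\<close>

lemma support_move_unit:
  assumes "D \<subseteq> verts G" "u \<in> verts G - D" "v \<in> D"
    and "\<And>y. y \<in> verts G \<Longrightarrow> g y = (if y \<in> D then 1 else 0)"
  shows "{x \<in> verts G. move_unit (\<lambda>y. real (g y)) v u x \<ge> 1} = insert u (D - {v})"
  using assms by (auto simp: move_unit_def split: if_splits)

lemma weak_roman_le_secure:
  assumes "secure_set G D"
  shows "weak_roman_domination_number G \<le> card D"
proof -
  define g :: "'a \<Rightarrow> nat" where "g = (\<lambda>y. if y \<in> D then 1 else 0)"
  have D: "D \<subseteq> verts G" using assms by (simp add: secure_set_def)
  have "weak_roman_dominating G g"
    unfolding weak_roman_dominating_def
  proof (intro conjI ballI impI)
    fix u assume u: "u \<in> verts G" "g u = 0"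
    then have uD: "u \<in> verts G - D" by (auto simp: g_def split: if_splits)
    then obtain v where v: "v \<in> D" "u \<rightarrow> v" "dominating_set G (insert u (D - {v}))"
      using assms unfolding secure_set_def by blast
    have "dominating_set G {x \<in> verts G. move_unit (\<lambda>y. real (g y)) v u x \<ge> 1}"
      using v support_move_unit[OF D uD v(1), of g] by (simp add: g_def)
    with v show "\<exists>v\<in>neighbors G u. 1 \<le> g v \<and>
        dominating_set G {x \<in> verts G. 1 \<le> move_unit (\<lambda>y. real (g y)) v u x}"
      by (auto simp: neighbors_def g_def)
  qed (auto simp: g_def)
  moreover have "(\<Sum>u\<in>verts G. g u) = card D"
    using D by (simp add: g_def sum.If_cases Int_absorb1)
  ultimately show ?thesis
    unfolding weak_roman_domination_number_def by (intro Least_le) metis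
qed

lemma weak_roman_attained:
  obtains g where "weak_roman_dominating G g"
    "weak_roman_domination_number G = (\<Sum>u\<in>verts G. g u)"
proof -
  let ?P = "\<lambda>n. \<exists>g. weak_roman_dominating G g \<and> n = (\<Sum>u\<in>verts G. g u)"
  have "weak_roman_dominating G (\<lambda>_. 1)"
    by (auto simp: weak_roman_dominating_def)
  then have "\<exists>n. ?P n"
    by (intro exI conjI) (assumption, rule refl)
  then have "?P (LEAST n. ?P n)"
    by (rule LeastI_ex)
  then show ?thesis
    using that unfolding weak_roman_domination_number_def by (elim exE conjE)
qed

lemma weak_roman_support:
  assumes "weak_roman_dominating G g"
  defines "D \<equiv> {x \<in> verts G. g x \<ge> 1}"
  shows "dominating_set G D" "card D \<le> (\<Sum>u\<in>verts G. g u)"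
proof -
  show "dominating_set G D"
    unfolding dominating_set_def
  proof (intro conjI ballI)
    fix u assume "u \<in> verts G - D"
    then have "u \<in> verts G" "g u = 0" by (auto simp: D_def)
    then obtain v where "v \<in> neighbors G u" "g v \<ge> 1"
      using assms(1) unfolding weak_roman_dominating_def by blast
    then show "neighbors G u \<inter> D \<noteq> {}"
      by (auto simp: D_def neighbors_def dest: adj_verts)
  qed (auto simp: D_def)
  have "card D = (\<Sum>u\<in>D. 1)" by simp
  also have "\<dots> \<le> (\<Sum>u\<in>D. g u)" by (intro sum_mono) (auto simp: D_def)
  also have "\<dots> \<le> (\<Sum>u\<in>verts G. g u)" by (intro sum_mono2) (auto simp: D_def)
  finally show "card D \<le> (\<Sum>u\<in>verts G. g u)" .
qed

lemma rainbow2_le_twice_weak_roman: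
  "rainbow2_domination_number G \<le> 2 * weak_roman_domination_number G"
proof -
  obtain g where g: "weak_roman_dominating G g"
    "weak_roman_domination_number G = (\<Sum>u\<in>verts G. g u)"
    by (rule weak_roman_attained)
  from rainbow2_le_dominating[OF weak_roman_support(1)[OF g(1)]] weak_roman_support(2)[OF g(1)] g(2)
  show ?thesis by linarith
qed

text \<open>
  The support \<open>D\<close> of an optimal function satisfies \<open>\<gamma>\<^sub>r\<^sub>2 \<le> 2 |D| \<le> 2 \<gamma>\<^sub>r\<close>. Equality at both ends
  makes \<open>|D|\<close> equal to the weight, so that the value 2 does not occur.
\<close>

lemma secure_set_if_extremal:
  assumes "rainbow2_domination_number G = 2 * weak_roman_domination_number G"
  obtains D where "secure_set G D" "card D = weak_roman_domination_number G"
proof -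
  obtain g where g: "weak_roman_dominating G g"
    "weak_roman_domination_number G = (\<Sum>u\<in>verts G. g u)"
    by (rule weak_roman_attained)
  define D where "D = {x \<in> verts G. g x \<ge> 1}"
  have DV: "D \<subseteq> verts G" by (auto simp: D_def)
  note supp = weak_roman_support[OF g(1), folded D_def]
  from rainbow2_le_dominating[OF supp(1)] supp(2) g(2) assms
  have card: "card D = (\<Sum>u\<in>verts G. g u)" by linarith
  have "(\<Sum>u\<in>verts G. g u) = (\<Sum>u\<in>D. g u)"
    by (intro sum.mono_neutral_right) (auto simp: D_def)
  with card have eq: "(\<Sum>u\<in>D. 1) = (\<Sum>u\<in>D. g u)" by simp
  have one: "g x = 1" if "x \<in> D" for x
  proof (rule ccontr)
    assume "g x \<noteq> 1"
    then have "1 < g x" using that by (auto simp: D_def)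
    then have "(\<Sum>u\<in>D. 1) < (\<Sum>u\<in>D. g u)"
      using that finite_subset[OF DV] by (intro sum_strict_mono_ex1) (auto simp: D_def)
    with eq show False by simp
  qed
  have g_eq: "g y = (if y \<in> D then 1 else 0)" if "y \<in> verts G" for y
    using that one by (auto simp: D_def)
  have "secure_set G D"
    unfolding secure_set_def
  proof (intro conjI ballI)
    fix u assume u: "u \<in> verts G - D"
    then have "u \<in> verts G" "g u = 0" by (auto simp: D_def)
    then obtain v where v: "v \<in> neighbors G u" "g v \<ge> 1"
      "dominating_set G {x \<in> verts G. move_unit (\<lambda>y. real (g y)) v u x \<ge> 1}"
      using g(1) unfolding weak_roman_dominating_def by blast
    have uv: "u \<rightarrow> v" using v by (simp add: neighbors_def)
    then have "v \<in> D" using v adj_verts by (auto simp: D_def)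
    have "{x \<in> verts G. move_unit (\<lambda>y. real (g y)) v u x \<ge> 1} = insert u (D - {v})"
      using DV u \<open>v \<in> D\<close> g_eq by (rule support_move_unit)
    with v(3) uv \<open>v \<in> D\<close>
    show "\<exists>v\<in>D. u \<rightarrow> v \<and> dominating_set G (insert u (D - {v}))" by auto
  qed (fact DV)
  with card g(2) that show ?thesis by simp
qed

section \<open>Partitions into cliques\<close>

lemma clique_partition_cover:
  assumes "clique_partition G \<C>"
  shows "\<Union> \<C> = verts G"
  using assms by (auto simp: clique_partition_def dest: partition_onD1)

lemma clique_partition_block_unique:
  assumes "clique_partition G \<C>" "A \<in> \<C>" "B \<in> \<C>" "x \<in> A" "x \<in> B"
  shows "A = B"
proof (rule ccontr)
  assume "A \<noteq> B"
  then have "A \<inter> B = {}"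
    using assms by (auto simp: clique_partition_def dest!: partition_onD2 dest: disjointD)
  with assms show False by blast
qed

lemma clique_partition_nonempty:
  assumes "clique_partition G \<C>" "A \<in> \<C>"
  shows "A \<noteq> {}"
  using assms by (auto simp: clique_partition_def dest: partition_onD3)

lemma clique_partition_adj:
  assumes "clique_partition G \<C>" "A \<in> \<C>" "x \<in> A" "y \<in> A" "x \<noteq> y"
  shows "x \<rightarrow> y"
  using assms by (auto simp: clique_partition_def)

lemma clique_partition_finite:
  assumes "clique_partition G \<C>"
  shows "finite \<C>"
  using assms finite_elements[OF finite_verts] by (auto simp: clique_partition_def)

text \<open>
  A transversal is secure: a vertex is defended by the representative of its own block, because
  moving that representative inside the block yields another transversal.
\<close>

lemma weak_roman_le_clique_partition:
  assumes P: "clique_partition G \<C>"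
  shows "weak_roman_domination_number G \<le> card \<C>"
proof -
  define t where "t C = (SOME x. x \<in> C)" for C :: "'a set"
  have t: "t C \<in> C" if "C \<in> \<C>" for C
    using clique_partition_nonempty[OF P that] by (auto simp: t_def some_in_eq)
  have "secure_set G (t ` \<C>)"
    unfolding secure_set_def
  proof (intro conjI ballI)
    show sub: "t ` \<C> \<subseteq> verts G"
      using t clique_partition_cover[OF P] by blast
    fix u assume u: "u \<in> verts G - t ` \<C>"
    then obtain C where C: "C \<in> \<C>" "u \<in> C"
      using clique_partition_cover[OF P] by blast
    then have ut: "u \<rightarrow> t C"
      using u t[of C] by (intro clique_partition_adj[OF P]) auto
    have "dominating_set G (insert u (t ` \<C> - {t C}))"
      unfolding dominating_set_def
    proof (intro conjI ballI)
      show "insert u (t ` \<C> - {t C}) \<subseteq> verts G" using sub u by auto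
      fix w assume w: "w \<in> verts G - insert u (t ` \<C> - {t C})"
      then obtain C' where C': "C' \<in> \<C>" "w \<in> C'"
        using clique_partition_cover[OF P] by blast
      show "neighbors G w \<inter> insert u (t ` \<C> - {t C}) \<noteq> {}"
      proof (cases "C' = C")
        case True
        then have "w \<rightarrow> u"
          using C C' w by (intro clique_partition_adj[OF P]) auto
        then show ?thesis by (auto simp: neighbors_def)
      next
        case False
        then have "t C' \<noteq> t C"
          using clique_partition_block_unique[OF P C'(1) C(1)] t[OF C'(1)] t[OF C(1)] by metis
        moreover from this have "w \<rightarrow> t C'"
          using C' w t[of C'] by (intro clique_partition_adj[OF P]) auto
        ultimately show ?thesis
          using C' by (auto simp: neighbors_def)
      qed
    qed
    with ut C show "\<exists>v\<in>t ` \<C>. u \<rightarrow> v \<and> dominating_set G (insert u (t ` \<C> - {v}))"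
      by blast
  qed
  then have "weak_roman_domination_number G \<le> card (t ` \<C>)"
    by (rule weak_roman_le_secure)
  also have "\<dots> \<le> card \<C>"
    using clique_partition_finite[OF P] by (rule card_image_le)
  finally show ?thesis .
qed

lemma card_eq_sum_blocks:
  assumes P: "clique_partition G \<C>" and "X \<subseteq> verts G"
  shows "card X = (\<Sum>C\<in>\<C>. card (X \<inter> C))"
proof -
  have fin: "finite X" using assms(2) finite_verts by (rule finite_subset)
  have "X = (\<Union>C\<in>\<C>. X \<inter> C)"
    using assms(2) clique_partition_cover[OF P] by blast
  then have "card X = card (\<Union>C\<in>\<C>. X \<inter> C)"
    by (rule arg_cong)
  also have "\<dots> = (\<Sum>C\<in>\<C>. card (X \<inter> C))"
    using clique_partition_finite[OF P] fin clique_partition_block_unique[OF P]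
    by (intro card_UN_disjoint) blast+
  finally show ?thesis .
qed

text \<open>
  If \<open>x\<close> or \<open>y\<close> is unlabelled, both colours must occur among its neighbours, all of which lie in
  the block; otherwise \<open>x\<close> and \<open>y\<close> carry at least one colour each.
\<close>

lemma block_weight_ge_2:
  assumes XY: "colour_classes G X Y" and "C \<subseteq> verts G"
    and xy: "x \<in> C" "y \<in> C" "x \<noteq> y"
    and closed: "\<And>z. x \<rightarrow> z \<Longrightarrow> z \<in> C" "\<And>z. y \<rightarrow> z \<Longrightarrow> z \<in> C"
  shows "2 \<le> card (X \<inter> C) + card (Y \<inter> C)"
proof -
  have fin: "finite (X \<inter> C)" "finite (Y \<inter> C)"
    using \<open>C \<subseteq> verts G\<close> finite_subset[OF _ finite_verts] by blast+
  show ?thesis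
  proof (cases "x \<in> X \<union> Y \<and> y \<in> X \<union> Y")
    case True
    then have "{x, y} \<subseteq> (X \<inter> C) \<union> (Y \<inter> C)" using xy by blast
    then have "card {x, y} \<le> card ((X \<inter> C) \<union> (Y \<inter> C))"
      using fin by (intro card_mono) auto
    with card_Un_le[of "X \<inter> C" "Y \<inter> C"] xy show ?thesis by simp
  next
    case False
    then obtain z where z: "z \<in> {x, y}" "z \<in> verts G - (X \<union> Y)"
      using xy \<open>C \<subseteq> verts G\<close> by blast
    then obtain p q where "p \<in> X" "z \<rightarrow> p" "q \<in> Y" "z \<rightarrow> q"
      using XY unfolding colour_classes_def by blast
    with z closed have "p \<in> X \<inter> C" "q \<in> Y \<inter> C" by auto
    with fin have "0 < card (X \<inter> C)" "0 < card (Y \<inter> C)"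
      by (auto simp: card_gt_0_iff)
    then show ?thesis by simp
  qed
qed

lemma rainbow2_ge_clique_partition:
  assumes P: "clique_partition G \<C>"
    and inner: "\<And>C. C \<in> \<C> \<Longrightarrow> \<exists>x \<in> C. \<exists>y \<in> C. x \<noteq> y \<and> (\<forall>z. x \<rightarrow> z \<or> y \<rightarrow> z \<longrightarrow> z \<in> C)"
  shows "2 * card \<C> \<le> rainbow2_domination_number G"
proof -
  obtain X Y where XY: "colour_classes G X Y" "rainbow2_domination_number G = card X + card Y"
    by (rule colour_classes_attained)
  have sub: "X \<subseteq> verts G" "Y \<subseteq> verts G"
    using XY by (auto simp: colour_classes_def)
  have "2 \<le> card (X \<inter> C) + card (Y \<inter> C)" if C: "C \<in> \<C>" for C
  proof -
    obtain x y where "x \<in> C" "y \<in> C" "x \<noteq> y" "\<forall>z. x \<rightarrow> z \<or> y \<rightarrow> z \<longrightarrow> z \<in> C"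
      using inner[OF C] by blast
    moreover have "C \<subseteq> verts G" using C clique_partition_cover[OF P] by blast
    ultimately show ?thesis
      using block_weight_ge_2[OF XY(1)] by blast
  qed
  then have "(\<Sum>C\<in>\<C>. 2) \<le> (\<Sum>C\<in>\<C>. card (X \<inter> C) + card (Y \<inter> C))"
    by (rule sum_mono)
  then show ?thesis
    using XY(2) card_eq_sum_blocks[OF P sub(1)] card_eq_sum_blocks[OF P sub(2)]
    by (simp add: sum.distrib)
qed

section \<open>Equality forces a partition into small cliques\<close>

text \<open>
  Two common neighbours \<open>u\<close>, \<open>v\<close> of adjacent \<open>x\<close>, \<open>y\<close> would induce \<open>K\<^sub>4\<close> or \<open>K\<^sub>4 - e\<close> on
  \<open>{x, y, u, v}\<close>, depending on whether \<open>u\<close> and \<open>v\<close> are adjacent.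
\<close>

lemma common_neighbour_unique:
  assumes free: "K4_diamond_free G"
    and "x \<rightarrow> y" "x \<rightarrow> u" "y \<rightarrow> u" "x \<rightarrow> v" "y \<rightarrow> v"
  shows "u = v"
proof (rule ccontr)
  assume "u \<noteq> v"
  define S where "S = {x, y, u, v}"
  have dist: "x \<noteq> y" "x \<noteq> u" "y \<noteq> u" "x \<noteq> v" "y \<noteq> v"
    using assms adj_neq by blast+
  have S: "S \<subseteq> verts G" "card S = 4"
    using assms adj_verts dist \<open>u \<noteq> v\<close> by (auto simp: S_def)
  have ind: "induced_subgraph (G \<restriction> S) G"
    using S by auto
  interpret H: digraph "G \<restriction> S" by (rule digraphI_induced[OF ind])
  interpret H: sym_digraph "G \<restriction> S" by (rule induced_graph_imp_graph[OF ind])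
  have gr: "graph (G \<restriction> S)" by unfold_locales
  have ends: "arcs_ends (G \<restriction> S) = {(a, b). a \<in> S \<and> b \<in> S \<and> a \<rightarrow> b}"
    by (auto simp: arcs_ends_conv)
  have adj: "a \<rightarrow> b" if "a \<in> S" "b \<in> S" "a \<noteq> b" "(a, b) \<noteq> (u, v)" "(a, b) \<noteq> (v, u)" for a b
    using that assms adj_sym by (auto simp: S_def)
  show False
  proof (cases "u \<rightarrow> v")
    case True
    then have "arcs_ends (G \<restriction> S) = {(a, b). (a, b) \<in> S \<times> S \<and> a \<noteq> b}"
      unfolding ends using adj adj_sym adj_neq by blast
    then have "complete_digraph 4 (G \<restriction> S)"
      using S gr by (simp add: complete_digraph_def)
    with ind free show False by (auto simp: K4_diamond_free_def)
  next
    case False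
    then have "arcs_ends (G \<restriction> S) = all_pairs S - {(u, v), (v, u)}"
      unfolding ends all_pairs_def using adj adj_sym adj_neq by blast
    moreover have "u \<in> S" "v \<in> S" by (auto simp: S_def)
    ultimately have "complete_minus_edge 4 (G \<restriction> S)"
      using S gr \<open>u \<noteq> v\<close> unfolding complete_minus_edge_def by auto
    with ind free show False by (auto simp: K4_diamond_free_def)
  qed
qed

text \<open>
  The blocks are the fibres of a map \<open>d\<close> that sends every vertex outside the secure set \<open>D\<close> to a
  defender and fixes \<open>D\<close> pointwise. The block of \<open>v\<close> contains \<open>v\<close> and its private neighbour
  \<open>p v\<close>; any further member is adjacent to both, so there is at most one.
\<close>

lemma clique_partition_if_extremal:
  assumes free: "K4_diamond_free G"
    and eq: "rainbow2_domination_number G = 2 * weak_roman_domination_number G"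
  obtains \<C> where "clique_partition G \<C>" "card \<C> = weak_roman_domination_number G"
    "\<And>C. C \<in> \<C> \<Longrightarrow> card C = 2 \<or> card C = 3"
proof -
  obtain D where D: "secure_set G D" "card D = weak_roman_domination_number G"
    by (rule secure_set_if_extremal[OF eq])
  have DV: "D \<subseteq> verts G" using D by (simp add: secure_set_def)
  have "\<forall>u\<in>verts G - D. \<exists>v. v \<in> D \<and> u \<rightarrow> v \<and> dominating_set G (insert u (D - {v}))"
    using D(1) unfolding secure_set_def by blast
  from bchoice[OF this] obtain e where
    e: "\<forall>u\<in>verts G - D. e u \<in> D \<and> u \<rightarrow> e u \<and> dominating_set G (insert u (D - {e u}))" ..
  define d where "d u = (if u \<in> D then u else e u)" for u
  have d_fix: "d u = u" if "u \<in> D" for u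
    using that by (simp add: d_def)
  have d_defends: "d u \<in> D \<and> u \<rightarrow> d u \<and> dominating_set G (insert u (D - {d u}))"
    if u: "u \<in> verts G - D" for u
    using e u by (simp add: d_def)
  have d_in: "d u \<in> D" if "u \<in> verts G" for u
    using that d_fix d_defends by (cases "u \<in> D") auto
  have "\<exists>p. p \<in> verts G - D \<and> d p = v \<and>
      (\<forall>u \<in> verts G - D. d u = v \<longrightarrow> u = p \<or> u \<rightarrow> p)" if v: "v \<in> D" for v
  proof -
    \<comment> \<open>A private neighbour exists, for otherwise \<open>D - {v}\<close> dominates everything except \<open>v\<close>.\<close>
    have "\<exists>p \<in> verts G - (D - {v}). p \<noteq> v \<and> (\<forall>t \<in> D - {v}. \<not> p \<rightarrow> t)"
    proof (rule ccontr)
      assume "\<not> ?thesis"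
      then have "rainbow2_domination_number G \<le> 2 * card (D - {v}) + 1"
        using DV v by (intro rainbow2_le_almost_dominating[where c = v]) blast+
      moreover have "card D \<noteq> 0"
        using v finite_subset[OF DV] by auto
      ultimately show False
        using D(2) eq v by simp
    qed
    then obtain p where p: "p \<in> verts G - D" "\<And>t. t \<in> D \<Longrightarrow> p \<rightarrow> t \<Longrightarrow> t = v"
      by blast
    have "d p = v" using p d_defends by blast
    moreover have "u = p \<or> u \<rightarrow> p" if u: "u \<in> verts G - D" "d u = v" for u
    proof (rule disjCI)
      \<comment> \<open>After the move from \<open>v\<close> to \<open>u\<close>, only \<open>u\<close> can dominate \<open>p\<close>.\<close>
      assume "\<not> u \<rightarrow> p"
      show "u = p"
      proof (rule ccontr)
        assume "u \<noteq> p"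
        then have "p \<in> verts G - insert u (D - {v})" using p by blast
        then obtain t where "t \<in> insert u (D - {v})" "p \<rightarrow> t"
          using d_defends[OF u(1)] u(2) unfolding dominating_set_def neighbors_def by blast
        with p \<open>\<not> u \<rightarrow> p\<close> adj_sym show False by blast
      qed
    qed
    ultimately show ?thesis using p by blast
  qed
  then have "\<forall>v\<in>D. \<exists>p. p \<in> verts G - D \<and> d p = v \<and>
      (\<forall>u \<in> verts G - D. d u = v \<longrightarrow> u = p \<or> u \<rightarrow> p)" by blast
  from bchoice[OF this] obtain p where p: "\<And>v. v \<in> D \<Longrightarrow> p v \<in> verts G - D"
    "\<And>v. v \<in> D \<Longrightarrow> d (p v) = v"
    "\<And>u v. v \<in> D \<Longrightarrow> u \<in> verts G - D \<Longrightarrow> d u = v \<Longrightarrow> u = p v \<or> u \<rightarrow> p v"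
    by auto
  define B where "B v = {u \<in> verts G. d u = v}" for v
  have vB: "v \<in> B v" if "v \<in> D" for v
    using that d_fix DV by (auto simp: B_def)
  have pB: "p v \<in> B v" if "v \<in> D" for v
    using that p by (auto simp: B_def)
  have B_adj: "u \<rightarrow> v \<and> u \<rightarrow> p v" if "u \<in> B v" "u \<noteq> v" "u \<noteq> p v" "v \<in> D" for u v
    using that d_fix[of u] d_defends[of u] p(3)[of v u] by (auto simp: B_def)
  have vp: "p v \<rightarrow> v" if "v \<in> D" for v
    using d_defends[OF p(1)[OF that]] p(2)[OF that] by simp
  have B_unique: "u = w"
    if "u \<in> B v" "u \<noteq> v" "u \<noteq> p v" "w \<in> B v" "w \<noteq> v" "w \<noteq> p v" "v \<in> D" for u w v
    using common_neighbour_unique[OF free vp[OF \<open>v \<in> D\<close>]] B_adj that adj_sym by blast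
  have "clique_partition G (B ` D)"
    unfolding clique_partition_def
  proof (intro conjI ballI impI)
    show "partition_on (verts G) (B ` D)"
    proof (rule partition_onI)
      show "\<Union> (B ` D) = verts G" using d_in by (auto simp: B_def)
      show "{} \<notin> B ` D" using vB by blast
      show "disjnt q q'" if "q \<in> B ` D" "q' \<in> B ` D" "q \<noteq> q'" for q q'
        using that by (auto simp: B_def disjnt_def)
    qed
    fix C x y assume C: "C \<in> B ` D" "x \<in> C" "y \<in> C" "x \<noteq> y"
    then obtain v where v: "v \<in> D" "C = B v" by blast
    consider "x \<in> {v, p v}" "y \<in> {v, p v}" | "x \<notin> {v, p v}" "y \<in> {v, p v}"
      | "x \<in> {v, p v}" "y \<notin> {v, p v}" | "x \<notin> {v, p v}" "y \<notin> {v, p v}" by blast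
    then show "x \<rightarrow> y"
    proof cases
      case 1
      then show ?thesis using C(4) vp[OF v(1)] adj_sym by auto
    next
      case 2
      then show ?thesis using B_adj[of x v] v C by auto
    next
      case 3
      then show ?thesis using B_adj[of y v] v C adj_sym by auto
    next
      case 4
      then show ?thesis using B_unique[of x v y] v C by auto
    qed
  qed
  moreover have "card (B ` D) = weak_roman_domination_number G"
  proof -
    have "inj_on B D"
    proof (rule inj_onI)
      fix x y assume "x \<in> D" "y \<in> D" "B x = B y"
      then have "x \<in> B y" using vB by blast
      with d_fix[OF \<open>x \<in> D\<close>] show "x = y" by (simp add: B_def)
    qed
    then show ?thesis using D(2) by (simp add: card_image)
  qed
  moreover have "card C = 2 \<or> card C = 3" if "C \<in> B ` D" for C
  proof -
    from that obtain v where v: "v \<in> D" "C = B v" by blast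
    have "v \<noteq> p v" using p(1)[OF v(1)] v(1) by auto
    show ?thesis
    proof (cases "\<exists>u \<in> B v. u \<noteq> v \<and> u \<noteq> p v")
      case True
      then obtain u where u: "u \<in> B v" "u \<noteq> v" "u \<noteq> p v" by blast
      then have "C = {v, p v, u}"
        using B_unique[OF _ _ _ u v(1)] vB[OF v(1)] pB[OF v(1)] v(2) by blast
      then show ?thesis using u \<open>v \<noteq> p v\<close> by auto
    next
      case False
      then have "C = {v, p v}" using vB[OF v(1)] pB[OF v(1)] v(2) by blast
      then show ?thesis using \<open>v \<noteq> p v\<close> by auto
    qed
  qed
  ultimately show ?thesis using that by blast
qed

section \<open>From the partition to the graph\<close>

text \<open>
  The outside neighbours \<open>x'\<close> and \<open>y'\<close> can be representatives at the same time unless they are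
  different vertices of one block. Representatives of the blocks other than \<open>A\<close> that include
  \<open>x'\<close> and \<open>y'\<close> dominate everything except possibly \<open>c\<close>, which is too cheap. The case \<open>x = y\<close>,
  \<open>x' = y'\<close> covers blocks of size two.
\<close>

lemma no_two_exits:
  assumes P: "clique_partition G \<C>" and ge: "2 * card \<C> \<le> rainbow2_domination_number G"
    and A: "A \<in> \<C>" "c \<in> A" "A \<subseteq> {x, y, c}"
    and x: "x \<rightarrow> x'" "x' \<notin> A" and y: "y \<rightarrow> y'" "y' \<notin> A"
    and compatible: "\<And>C. C \<in> \<C> \<Longrightarrow> x' \<in> C \<Longrightarrow> y' \<in> C \<Longrightarrow> x' = y'"
  shows False
proof -
  define t where
    "t C = (if x' \<in> C then x' else if y' \<in> C then y' else (SOME z. z \<in> C))" for C :: "'a set"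
  define T where "T = t ` (\<C> - {A})"
  have t: "t C \<in> C" if "C \<in> \<C>" for C
    using clique_partition_nonempty[OF P that] by (auto simp: t_def some_in_eq)
  have xT: "z \<in> T" if z: "z \<in> {x', y'}" for z
  proof -
    have "z \<in> verts G" "z \<notin> A" using z x y adj_verts by auto
    then obtain C where "C \<in> \<C> - {A}" "z \<in> C"
      using clique_partition_cover[OF P] by blast
    moreover from this z compatible have "t C = z" by (auto simp: t_def)
    ultimately show ?thesis unfolding T_def by blast
  qed
  have sub: "T \<subseteq> verts G"
    using t clique_partition_cover[OF P] by (auto simp: T_def)
  have "\<exists>s \<in> T. u \<rightarrow> s" if u: "u \<in> verts G - T" "u \<noteq> c" for u
  proof -
    obtain C where C: "C \<in> \<C>" "u \<in> C" using u clique_partition_cover[OF P] by blast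
    show ?thesis
    proof (cases "C = A")
      case True
      then have "u = x \<or> u = y" using C u A by blast
      then show ?thesis using x y xT by blast
    next
      case False
      then have "t C \<in> T" using C by (auto simp: T_def)
      moreover have "u \<rightarrow> t C"
        using C u t[of C] calculation by (intro clique_partition_adj[OF P C(1)]) auto
      ultimately show ?thesis by blast
    qed
  qed
  moreover have "c \<in> verts G" using A clique_partition_cover[OF P] by blast
  ultimately have "rainbow2_domination_number G \<le> 2 * card T + 1"
    using sub by (intro rainbow2_le_almost_dominating)
  moreover have "card T \<le> card \<C> - 1"
    using card_image_le[of "\<C> - {A}" t] clique_partition_finite[OF P] A by (simp add: T_def)
  moreover have "card \<C> > 0"
    using A clique_partition_finite[OF P] by (auto simp: card_gt_0_iff)
  ultimately show False using ge by linarith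
qed

lemma connected_closed_set:
  assumes conn: "Digraph_Component.connected G"
    and "S \<subseteq> verts G" "S \<noteq> {}" and closed: "\<And>x y. x \<in> S \<Longrightarrow> x \<rightarrow> y \<Longrightarrow> y \<in> S"
  shows "S = verts G"
proof -
  have "strongly_connected G"
    using conn sym_arcs by (intro symmetric_connected_imp_strongly_connected)
  moreover obtain s where s: "s \<in> S" using \<open>S \<noteq> {}\<close> by blast
  ultimately have "s \<rightarrow>\<^sup>* v" if "v \<in> verts G" for v
    using that \<open>S \<subseteq> verts G\<close> by (auto simp: strongly_connected_def)
  moreover have "v \<in> S" if "s \<rightarrow>\<^sup>* v" for v
    using that s by (induction rule: reachable_induct) (use closed in auto)
  ultimately show ?thesis using \<open>S \<subseteq> verts G\<close> by blast
qed

lemma third_vertex: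
  assumes "card A = 3" "x \<in> A" "y \<in> A" "x \<noteq> y"
  obtains z where "A = {x, y, z}" "z \<noteq> x" "z \<noteq> y"
proof -
  have "finite A" using assms(1) card_eq_0_iff[of A] by auto
  then have "card (A - {x, y}) = 1"
    using assms by (simp add: card_Diff_subset)
  then obtain z where "A - {x, y} = {z}" by (rule card_1_singletonE)
  then have "A = {x, y, z}" "z \<noteq> x" "z \<noteq> y" using assms by blast+
  then show ?thesis by (rule that)
qed

text \<open>
  Otherwise \<open>x\<close> and the third vertex of the triangle would both be common neighbours of \<open>y\<close> and
  \<open>y'\<close>.
\<close>

lemma unique_neighbour_in_triangle:
  assumes free: "K4_diamond_free G" and P: "clique_partition G \<C>"
    and C: "C \<in> \<C>" "card C = 3" "y \<in> C" "y' \<in> C" "x \<notin> C" and "x \<rightarrow> y" "x \<rightarrow> y'"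
  shows "y = y'"
proof (rule ccontr)
  assume "y \<noteq> y'"
  then obtain z where z: "C = {y, y', z}" "z \<noteq> y" "z \<noteq> y'"
    using third_vertex[OF C(2,3,4)] by blast
  then have "y \<rightarrow> y'" "y \<rightarrow> z" "y' \<rightarrow> z"
    using clique_partition_adj[OF P C(1)] \<open>y \<noteq> y'\<close> by auto
  moreover have "y \<rightarrow> x" "y' \<rightarrow> x"
    using \<open>x \<rightarrow> y\<close> \<open>x \<rightarrow> y'\<close> by (auto intro: adj_sym)
  ultimately have "z = x"
    by (intro common_neighbour_unique[OF free])
  then show False using z C by blast
qed

lemma exits_in_same_block:
  assumes P: "clique_partition G \<C>" and ge: "2 * card \<C> \<le> rainbow2_domination_number G"
    and A: "A \<in> \<C>" "card A = 3" "x \<in> A" "y \<in> A" "x \<noteq> y"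
    and x: "x \<rightarrow> x'" "x' \<notin> A" and y: "y \<rightarrow> y'" "y' \<notin> A"
    and C: "C \<in> \<C>" "x' \<in> C"
  shows "y' \<in> C"
proof (rule ccontr)
  assume nin: "y' \<notin> C"
  obtain c where c: "A = {x, y, c}"
    using third_vertex[OF A(2-5)] by blast
  have "x' = y'" if "C' \<in> \<C>" "x' \<in> C'" "y' \<in> C'" for C'
    using clique_partition_block_unique[OF P that(1) C(1) that(2) C(2)] that nin by blast
  then show False
    using no_two_exits[OF P ge A(1) _ _ x y, of c] c by blast
qed

text \<open>
  The exits \<open>a'\<close> and \<open>b'\<close> lie in one triangle \<open>B\<close>, and they are different vertices, since otherwise
  the vertex \<open>a' = b'\<close> would have two neighbours in the triangle \<open>A\<close>. So \<open>B\<close> has two exits as well, both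
  leading to \<open>A\<close>. Every edge leaving \<open>A\<close> then ends in \<open>B\<close> and conversely, and connectedness leaves
  no room for further vertices.
\<close>

lemma two_triangles_if_two_exits:
  assumes conn: "Digraph_Component.connected G" and free: "K4_diamond_free G"
    and P: "clique_partition G \<C>" and ge: "2 * card \<C> \<le> rainbow2_domination_number G"
    and tri: "\<And>C. C \<in> \<C> \<Longrightarrow> card C = 3"
    and A: "A \<in> \<C>" and a: "a \<in> A" "a \<rightarrow> a'" "a' \<notin> A" and b: "b \<in> A" "b \<rightarrow> b'" "b' \<notin> A"
    and "a \<noteq> b"
  shows "two_triangles_with_matching G"
proof -
  note same = exits_in_same_block[OF P ge]
  note unique = unique_neighbour_in_triangle[OF free P]
  obtain B where B: "B \<in> \<C>" "a' \<in> B"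
    using a adj_verts clique_partition_cover[OF P] by blast
  have "b' \<in> B" by (rule same[OF A tri[OF A] a(1) b(1) \<open>a \<noteq> b\<close> a(2,3) b(2,3) B])
  have disj: "A \<inter> B = {}"
    using clique_partition_block_unique[OF P A B(1)] a B by blast
  have "a' \<noteq> b'"
  proof
    assume "a' = b'"
    then have "a = b"
      using unique[OF A tri[OF A] a(1) b(1) a(3)] a b adj_sym by blast
    with \<open>a \<noteq> b\<close> show False ..
  qed
  \<comment> \<open>Stated for generic \<open>C\<close> and \<open>C'\<close> because it is needed for \<open>A\<close>, \<open>B\<close> and for \<open>B\<close>, \<open>A\<close>. A vertex
    \<open>z\<close> differs from one of \<open>c\<close> and \<open>d\<close>, whose exit then fixes the block of \<open>z'\<close>.\<close>
  have exits: "z' \<in> C \<union> C'"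
    if C: "C \<in> \<C>" "C' \<in> \<C>" "C \<inter> C' = {}" "c \<in> C" "d \<in> C" "c \<noteq> d" "c \<rightarrow> c'" "d \<rightarrow> d'"
      "c' \<in> C'" "d' \<in> C'" and z: "z \<in> C" "z \<rightarrow> z'" for C C' c c' d d' z z'
  proof (rule ccontr)
    assume nin: "z' \<notin> C \<union> C'"
    have "c' \<notin> C" "d' \<notin> C" using C by blast+
    show False
    proof (cases "z = c")
      case True
      then have "z' \<in> C'"
        using same[OF C(1) tri[OF C(1)] \<open>d \<in> C\<close> \<open>z \<in> C\<close> _ \<open>d \<rightarrow> d'\<close> \<open>d' \<notin> C\<close> \<open>z \<rightarrow> z'\<close> _ C(2) \<open>d' \<in> C'\<close>]
          nin \<open>c \<noteq> d\<close> by blast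
      with nin show False by blast
    next
      case False
      then have "z' \<in> C'"
        using same[OF C(1) tri[OF C(1)] \<open>c \<in> C\<close> \<open>z \<in> C\<close> _ \<open>c \<rightarrow> c'\<close> \<open>c' \<notin> C\<close> \<open>z \<rightarrow> z'\<close> _ C(2) \<open>c' \<in> C'\<close>]
          nin by blast
      with nin show False by blast
    qed
  qed
  have V: "A \<union> B = verts G"
  proof (rule connected_closed_set[OF conn])
    show "A \<union> B \<subseteq> verts G" using A B clique_partition_cover[OF P] by blast
    show "A \<union> B \<noteq> {}" using B by blast
    fix x y assume "x \<in> A \<union> B" "x \<rightarrow> y"
    then consider "x \<in> A" | "x \<in> B" by blast
    then show "y \<in> A \<union> B"
    proof cases
      case 1
      then show ?thesis
        using exits[OF A B(1) disj a(1) b(1) \<open>a \<noteq> b\<close> a(2) b(2) B(2) \<open>b' \<in> B\<close>] \<open>x \<rightarrow> y\<close> by blast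
    next
      case 2
      moreover have "B \<inter> A = {}" using disj by blast
      ultimately have "y \<in> B \<union> A"
        using exits[OF B(1) A _ B(2) \<open>b' \<in> B\<close> \<open>a' \<noteq> b'\<close> _ _ a(1) b(1)]
          adj_sym[OF a(2)] adj_sym[OF b(2)] \<open>x \<rightarrow> y\<close> by blast
      then show ?thesis by blast
    qed
  qed
  have "\<C> = {A, B}"
  proof
    show "\<C> \<subseteq> {A, B}"
    proof
      fix C assume C: "C \<in> \<C>"
      then obtain x where x: "x \<in> C" using clique_partition_nonempty[OF P] by blast
      then have "x \<in> A \<or> x \<in> B" using C clique_partition_cover[OF P] V by blast
      then show "C \<in> {A, B}"
        using clique_partition_block_unique[OF P C] A B x by blast
    qed
  qed (use A B in blast)
  moreover have "A \<noteq> B" using a B by blast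
  ultimately have ge4: "4 \<le> rainbow2_domination_number G" using ge by simp
  define M where "M = {(x, y). x \<in> A \<and> y \<in> B \<and> x \<rightarrow> y}"
  have M: "M \<subseteq> A \<times> B" by (auto simp: M_def)
  have fin: "finite A" "finite B"
    using tri[OF A] tri[OF B(1)] card_eq_0_iff[of A] card_eq_0_iff[of B] by auto
  then have finM: "finite M" using M finite_subset by blast
  have fst: "inj_on fst M"
  proof (rule inj_onI)
    fix p q assume pq: "p \<in> M" "q \<in> M" "fst p = fst q"
    then obtain x y y' where xy: "p = (x, y)" "q = (x, y')" by (metis prod.collapse)
    then have "x \<in> A" "y \<in> B" "y' \<in> B" "x \<rightarrow> y" "x \<rightarrow> y'" using pq by (auto simp: M_def)
    then have "y = y'" using unique[OF B(1) tri[OF B(1)]] disj by blast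
    with xy show "p = q" by simp
  qed
  have snd: "inj_on snd M"
  proof (rule inj_onI)
    fix p q assume pq: "p \<in> M" "q \<in> M" "snd p = snd q"
    then obtain x x' y where xy: "p = (x, y)" "q = (x', y)" by (metis prod.collapse)
    then have "y \<in> B" "x \<in> A" "x' \<in> A" "y \<rightarrow> x" "y \<rightarrow> x'"
      using pq by (auto simp: M_def intro: adj_sym)
    then have "x = x'" using unique[OF A tri[OF A]] disj by blast
    with xy show "p = q" by simp
  qed
  \<comment> \<open>A perfect matching would give the prism, in which colour 1 on \<open>a\<close>, \<open>c\<close> and colour 2 on \<open>b'\<close>
    is a rainbow dominating function of weight 3.\<close>
  have "card M \<noteq> 3"
  proof
    assume "card M = 3"
    then have "card (fst ` M) = card A" using fst tri[OF A] by (simp add: card_image)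
    moreover have "fst ` M \<subseteq> A" using M by auto
    ultimately have "fst ` M = A" using fin by (intro card_subset_eq)
    obtain c where c: "A = {a, b, c}" "c \<noteq> a" "c \<noteq> b"
      using third_vertex[OF tri[OF A] a(1) b(1) \<open>a \<noteq> b\<close>] by blast
    then have "c \<in> fst ` M" using \<open>fst ` M = A\<close> by blast
    then obtain c' where c': "c' \<in> B" "c \<rightarrow> c'" by (auto simp: M_def)
    have c'_neq: "c' \<noteq> a'" "c' \<noteq> b'"
      using inj_onD[OF snd, of "(c, c')" "(a, a')"] inj_onD[OF snd, of "(c, c')" "(b, b')"]
        a b c c' B \<open>b' \<in> B\<close> by (auto simp: M_def)
    then have "B = {a', b', c'}"
      using third_vertex[OF tri[OF B(1)] B(2) \<open>b' \<in> B\<close> \<open>a' \<noteq> b'\<close>] c'(1) by blast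
    then have V6: "verts G = {a, b, c, a', b', c'}" using V c by blast
    have "b \<rightarrow> a" using clique_partition_adj[OF P A b(1) a(1)] \<open>a \<noteq> b\<close> by blast
    moreover have "a' \<rightarrow> b'"
      using clique_partition_adj[OF P B \<open>b' \<in> B\<close> \<open>a' \<noteq> b'\<close>] .
    moreover have "c' \<rightarrow> b'"
      using clique_partition_adj[OF P B(1) c'(1) \<open>b' \<in> B\<close> c'_neq(2)] .
    moreover note adj_sym[OF a(2)] adj_sym[OF c'(2)] b(2)
    ultimately have "colour_classes G {a, c} {b'}"
      unfolding colour_classes_def V6 by auto
    from rainbow2_le_colour_classes[OF this] ge4 show False
      using \<open>c \<noteq> a\<close> by simp
  qed
  moreover have "card M \<le> 3"
  proof -
    have "fst ` M \<subseteq> A" using M by auto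
    from card_inj_on_le[OF fst this fin(1)] tri[OF A] show ?thesis by simp
  qed
  moreover have "2 \<le> card M"
  proof -
    have "{(a, a'), (b, b')} \<subseteq> M" using a b B \<open>b' \<in> B\<close> by (auto simp: M_def)
    then have "card {(a, a'), (b, b')} \<le> card M" using finM by (rule card_mono[rotated])
    then show ?thesis using \<open>a \<noteq> b\<close> by simp
  qed
  ultimately have cardM: "card M = 2" by linarith
  have "arcs_ends G = all_pairs A \<union> all_pairs B \<union> M \<union> M\<inverse>" (is "_ = ?R")
  proof (rule set_eqI, clarify)
    fix x y
    show "x \<rightarrow> y \<longleftrightarrow> (x, y) \<in> ?R"
    proof
      assume xy: "x \<rightarrow> y"
      then have "x \<in> A \<union> B" "y \<in> A \<union> B" "x \<noteq> y" "y \<rightarrow> x"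
        using adj_verts V adj_neq adj_sym by auto
      then show "(x, y) \<in> ?R" using xy by (auto simp: all_pairs_def M_def)
    next
      assume "(x, y) \<in> ?R"
      then show "x \<rightarrow> y"
        using clique_partition_adj[OF P A] clique_partition_adj[OF P B(1)] adj_sym
        by (auto simp: all_pairs_def M_def)
    qed
  qed
  with tri[OF A] tri[OF B(1)] disj V M cardM fst snd show ?thesis
    unfolding two_triangles_with_matching_def by blast
qed

text \<open>
  Here \<open>v C\<close> is the only vertex of \<open>C\<close> that has neighbours outside \<open>C\<close>, or an arbitrary one if there
  is none. An edge between different triangles therefore joins two of the \<open>v C\<close>.
\<close>

lemma triangles_joined_if_single_exits:
  assumes P: "clique_partition G \<C>" and tri: "\<And>C. C \<in> \<C> \<Longrightarrow> card C = 3"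
    and single: "\<And>C x y x' y'. C \<in> \<C> \<Longrightarrow> x \<in> C \<Longrightarrow> y \<in> C \<Longrightarrow> x \<rightarrow> x' \<Longrightarrow> x' \<notin> C \<Longrightarrow>
      y \<rightarrow> y' \<Longrightarrow> y' \<notin> C \<Longrightarrow> x = y"
  shows "triangles_joined_at_vertices (card \<C>) G"
proof -
  have "\<forall>C\<in>\<C>. \<exists>v. v \<in> C \<and> (\<forall>x x'. x \<in> C \<and> x \<rightarrow> x' \<and> x' \<notin> C \<longrightarrow> x = v)"
  proof
    fix C assume C: "C \<in> \<C>"
    obtain v0 where "v0 \<in> C" using clique_partition_nonempty[OF P C] by blast
    show "\<exists>v. v \<in> C \<and> (\<forall>x x'. x \<in> C \<and> x \<rightarrow> x' \<and> x' \<notin> C \<longrightarrow> x = v)"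
    proof (cases "\<exists>v v'. v \<in> C \<and> v \<rightarrow> v' \<and> v' \<notin> C")
      case True
      then obtain v v' where "v \<in> C" "v \<rightarrow> v'" "v' \<notin> C" by blast
      with single[OF C] show ?thesis by (intro exI[of _ v]) blast
    next
      case False
      with \<open>v0 \<in> C\<close> show ?thesis by blast
    qed
  qed
  from bchoice[OF this] obtain v where v: "\<And>C. C \<in> \<C> \<Longrightarrow> v C \<in> C"
    "\<And>C x x'. C \<in> \<C> \<Longrightarrow> x \<in> C \<Longrightarrow> x \<rightarrow> x' \<Longrightarrow> x' \<notin> C \<Longrightarrow> x = v C" by blast
  have "\<forall>C\<in>\<C>. \<exists>w. w \<in> C \<and> w \<noteq> v C"
  proof
    fix C assume "C \<in> \<C>"
    then have "\<not> C \<subseteq> {v C}" using tri[of C] card_mono[of "{v C}" C] by auto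
    then show "\<exists>w. w \<in> C \<and> w \<noteq> v C" by blast
  qed
  from bchoice[OF this] obtain w where w: "\<And>C. C \<in> \<C> \<Longrightarrow> w C \<in> C" "\<And>C. C \<in> \<C> \<Longrightarrow> w C \<noteq> v C"
    by blast
  have "\<forall>C\<in>\<C>. \<exists>u. C = {v C, w C, u} \<and> u \<noteq> v C \<and> u \<noteq> w C"
  proof
    fix C assume "C \<in> \<C>"
    then show "\<exists>u. C = {v C, w C, u} \<and> u \<noteq> v C \<and> u \<noteq> w C"
      using third_vertex[OF tri v(1) w(1)] w(2) by metis
  qed
  from bchoice[OF this] obtain u where u:
    "\<forall>C\<in>\<C>. C = {v C, w C, u C} \<and> u C \<noteq> v C \<and> u C \<noteq> w C" ..
  then have eq: "{v C, w C, u C} = C" if "C \<in> \<C>" for C using that by blast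
  obtain h where h: "bij_betw h {1..card \<C>} \<C>"
    using ex_bij_betw_nat_finite_1[OF clique_partition_finite[OF P]] by blast
  have hC: "h i \<in> \<C>" if "i \<in> {1..card \<C>}" for i
    using h that by (auto simp: bij_betw_def)
  have him: "h ` {1..card \<C>} = \<C>" using h by (simp add: bij_betw_def)
  define F where "F = {(x, y). x \<rightarrow> y \<and> x \<in> v ` \<C> \<and> y \<in> v ` \<C>}"
  have vh: "(v \<circ> h) ` {1..card \<C>} = v ` \<C>" unfolding image_comp[symmetric] him ..
  have dist: "\<forall>i\<in>{1..card \<C>}. distinct [(v \<circ> h) i, (w \<circ> h) i, (u \<circ> h) i]"
    using u w(2) hC by (metis comp_apply distinct_length_2_or_more distinct_singleton)
  have disj: "\<forall>i\<in>{1..card \<C>}. \<forall>j\<in>{1..card \<C>}. i \<noteq> j \<longrightarrow>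
      {(v \<circ> h) i, (w \<circ> h) i, (u \<circ> h) i} \<inter> {(v \<circ> h) j, (w \<circ> h) j, (u \<circ> h) j} = {}"
  proof (intro ballI impI)
    fix i j assume ij: "i \<in> {1..card \<C>}" "j \<in> {1..card \<C>}" "i \<noteq> j"
    then have "h i \<noteq> h j" using h by (auto simp: bij_betw_def dest: inj_onD)
    then have "h i \<inter> h j = {}"
      using clique_partition_block_unique[OF P hC[OF ij(1)] hC[OF ij(2)]] by blast
    then show "{(v \<circ> h) i, (w \<circ> h) i, (u \<circ> h) i} \<inter> {(v \<circ> h) j, (w \<circ> h) j, (u \<circ> h) j} = {}"
      unfolding comp_apply eq[OF hC[OF ij(1)]] eq[OF hC[OF ij(2)]] .
  qed
  have verts: "verts G = (\<Union>i\<in>{1..card \<C>}. {(v \<circ> h) i, (w \<circ> h) i, (u \<circ> h) i})"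
  proof -
    have "(\<Union>i\<in>{1..card \<C>}. {(v \<circ> h) i, (w \<circ> h) i, (u \<circ> h) i}) = (\<Union>i\<in>{1..card \<C>}. h i)"
      using eq hC by (intro SUP_cong) auto
    also have "\<dots> = verts G" using him clique_partition_cover[OF P] by simp
    finally show ?thesis ..
  qed
  have F: "F \<subseteq> all_pairs ((v \<circ> h) ` {1..card \<C>})" "sym F"
    using adj_neq adj_sym unfolding vh by (auto simp: F_def all_pairs_def intro!: symI)
  have arcs: "arcs_ends G = (\<Union>i\<in>{1..card \<C>}. all_pairs {(v \<circ> h) i, (w \<circ> h) i, (u \<circ> h) i}) \<union> F"
  proof -
    have "(\<Union>i\<in>{1..card \<C>}. all_pairs {(v \<circ> h) i, (w \<circ> h) i, (u \<circ> h) i})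
        = (\<Union>i\<in>{1..card \<C>}. all_pairs (h i))"
      using eq hC by (intro SUP_cong) auto
    also have "\<dots> = (\<Union>C\<in>\<C>. all_pairs C)" using him by (metis image_image)
    finally have eqU: "(\<Union>i\<in>{1..card \<C>}. all_pairs {(v \<circ> h) i, (w \<circ> h) i, (u \<circ> h) i})
        = (\<Union>C\<in>\<C>. all_pairs C)" .
    have "x \<rightarrow> y \<longleftrightarrow> (x, y) \<in> (\<Union>C\<in>\<C>. all_pairs C) \<union> F" for x y
    proof
      assume xy: "x \<rightarrow> y"
      then obtain C D where CD: "C \<in> \<C>" "x \<in> C" "D \<in> \<C>" "y \<in> D"
        using adj_verts clique_partition_cover[OF P] by blast
      show "(x, y) \<in> (\<Union>C\<in>\<C>. all_pairs C) \<union> F"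
      proof (cases "C = D")
        case True
        then show ?thesis using CD adj_neq[OF xy] by (auto simp: all_pairs_def)
      next
        case False
        then have "y \<notin> C" "x \<notin> D"
          using CD clique_partition_block_unique[OF P CD(1,3)] by blast+
        then have "x = v C" "y = v D"
          using v(2) CD xy adj_sym by blast+
        then show ?thesis using xy CD by (auto simp: F_def)
      qed
    next
      assume "(x, y) \<in> (\<Union>C\<in>\<C>. all_pairs C) \<union> F"
      then show "x \<rightarrow> y"
        using clique_partition_adj[OF P] by (auto simp: all_pairs_def F_def)
    qed
    then show ?thesis unfolding eqU by auto
  qed
  from dist disj verts F arcs show ?thesis
    unfolding triangles_joined_at_vertices_def by blast
qed

lemma extremal_structure:
  assumes conn: "Digraph_Component.connected G" and free: "K4_diamond_free G"
    and eq: "rainbow2_domination_number G = 2 * weak_roman_domination_number G"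
  shows "complete_digraph 2 G \<or> two_triangles_with_matching G \<or>
    triangles_joined_at_vertices (weak_roman_domination_number G) G"
proof -
  obtain \<C> where P: "clique_partition G \<C>" and k: "card \<C> = weak_roman_domination_number G"
    and size: "\<And>C. C \<in> \<C> \<Longrightarrow> card C = 2 \<or> card C = 3"
    by (rule clique_partition_if_extremal[OF free eq]) blast
  have ge: "2 * card \<C> \<le> rainbow2_domination_number G" using k eq by simp
  show ?thesis
  proof (cases "\<exists>A\<in>\<C>. card A = 2")
    case True
    then obtain A where A: "A \<in> \<C>" "card A = 2" by blast
    then obtain x y where xy: "A = {x, y}" "x \<noteq> y" by (auto simp: card_2_iff)
    have closed: "z' \<in> A" if z: "z \<in> A" "z \<rightarrow> z'" for z z'
    proof (rule ccontr)
      assume "z' \<notin> A"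
      obtain c where c: "A = {z, c}" using xy z by blast
      show False
        by (rule no_two_exits[OF P ge A(1), of c z z z' z']) (use c z \<open>z' \<notin> A\<close> in auto)
    qed
    have "A \<subseteq> verts G" using A(1) clique_partition_cover[OF P] by blast
    then have "A = verts G"
      using xy by (intro connected_closed_set[OF conn _ _ closed]) auto
    then have "arcs_ends G = {(u, v). (u, v) \<in> verts G \<times> verts G \<and> u \<noteq> v}"
      using clique_partition_adj[OF P A(1)] adj_verts adj_neq by blast
    then have "complete_digraph 2 G"
      using graph_axioms A(2) \<open>A = verts G\<close> by (simp add: complete_digraph_def)
    then show ?thesis by blast
  next
    case False
    then have tri: "card C = 3" if "C \<in> \<C>" for C using size that by blast
    show ?thesis
    proof (cases "\<exists>A a b a' b'. A \<in> \<C> \<and> a \<in> A \<and> a \<rightarrow> a' \<and> a' \<notin> A \<and> b \<in> A \<and> b \<rightarrow> b' \<and> b' \<notin> A \<and> a \<noteq> b")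
      case True
      then have "two_triangles_with_matching G"
        by (elim exE conjE) (rule two_triangles_if_two_exits[OF conn free P ge tri])
      then show ?thesis by blast
    next
      case False
      then have "triangles_joined_at_vertices (card \<C>) G"
        by (intro triangles_joined_if_single_exits[OF P tri]) blast+
      with k show ?thesis by simp
    qed
  qed
qed

section \<open>The three families are extremal\<close>

lemma extremal_if_clique_partition:
  assumes "clique_partition G \<C>" "2 * card \<C> \<le> rainbow2_domination_number G"
  shows "rainbow2_domination_number G = 2 * weak_roman_domination_number G"
  using weak_roman_le_clique_partition[OF assms(1)] assms(2) rainbow2_le_twice_weak_roman
  by linarith

lemma extremal_if_K2:
  assumes "complete_digraph 2 G"
  shows "rainbow2_domination_number G = 2 * weak_roman_domination_number G"
proof -
  have V: "card (verts G) = 2" and adj: "\<And>x y. x \<in> verts G \<Longrightarrow> y \<in> verts G \<Longrightarrow> x \<noteq> y \<Longrightarrow> x \<rightarrow> y"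
    using assms by (auto simp: complete_digraph_def)
  obtain x y where "verts G = {x, y}" "x \<noteq> y" using V by (auto simp: card_2_iff)
  then have xy: "x \<in> verts G" "y \<in> verts G" "x \<noteq> y" by auto
  then have P: "clique_partition G {verts G}"
    using adj by (auto simp: clique_partition_def intro!: partition_on_space)
  moreover have "2 * card {verts G} \<le> rainbow2_domination_number G"
    using xy adj_verts by (intro rainbow2_ge_clique_partition[OF P]) blast
  ultimately show ?thesis by (rule extremal_if_clique_partition)
qed

text \<open>
  The neighbours of \<open>w i\<close> and \<open>u i\<close> all lie in their own triangle, which therefore carries weight
  at least 2.
\<close>

lemma extremal_if_triangles_joined:
  assumes "triangles_joined_at_vertices (weak_roman_domination_number G) G"
  shows "rainbow2_domination_number G = 2 * weak_roman_domination_number G"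
proof -
  define k where "k = weak_roman_domination_number G"
  obtain v w u F where
    dist: "\<forall>i\<in>{1..k}. distinct [v i, w i, u i]" and
    disj: "\<forall>i\<in>{1..k}. \<forall>j\<in>{1..k}. i \<noteq> j \<longrightarrow> {v i, w i, u i} \<inter> {v j, w j, u j} = {}" and
    verts: "verts G = (\<Union>i\<in>{1..k}. {v i, w i, u i})" and
    F: "F \<subseteq> all_pairs (v ` {1..k})" and
    arcs: "arcs_ends G = (\<Union>i\<in>{1..k}. all_pairs {v i, w i, u i}) \<union> F"
    using assms unfolding triangles_joined_at_vertices_def k_def[symmetric]
    by (elim exE conjE) (rule that; assumption)
  define T where "T i = {v i, w i, u i}" for i
  have T_unique: "i = j" if "i \<in> {1..k}" "j \<in> {1..k}" "x \<in> T i" "x \<in> T j" for i j x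
    using disj that unfolding T_def by blast
  have "inj_on T {1..k}"
  proof (rule inj_onI)
    fix i j assume "i \<in> {1..k}" "j \<in> {1..k}" "T i = T j"
    moreover have "v i \<in> T i" by (simp add: T_def)
    ultimately show "i = j" using T_unique by blast
  qed
  then have card: "card (T ` {1..k}) = k" by (simp add: card_image)
  have adj: "x \<rightarrow> y" if "i \<in> {1..k}" "x \<in> T i" "y \<in> T i" "x \<noteq> y" for i x y
    using that unfolding arcs T_def all_pairs_def by blast
  have P: "clique_partition G (T ` {1..k})"
    unfolding clique_partition_def
  proof (intro conjI ballI impI)
    show "partition_on (verts G) (T ` {1..k})"
    proof (rule partition_onI)
      show "\<Union> (T ` {1..k}) = verts G" unfolding verts T_def ..
      show "disjnt p q" if "p \<in> T ` {1..k}" "q \<in> T ` {1..k}" "p \<noteq> q" for p q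
        using that T_unique unfolding disjnt_def by blast
      show "{} \<notin> T ` {1..k}" by (auto simp: T_def)
    qed
  qed (use adj in blast)
  have inner: "z \<in> T i" if i: "i \<in> {1..k}" and x: "x = w i \<or> x = u i" and xz: "x \<rightarrow> z" for i x z
  proof -
    have xT: "x \<in> T i" using x by (auto simp: T_def)
    have "x \<notin> v ` {1..k}"
    proof
      assume "x \<in> v ` {1..k}"
      then obtain j where j: "j \<in> {1..k}" "x = v j" by blast
      then have "i = j" using T_unique[OF i j(1) xT] by (simp add: T_def)
      then show False using dist i x j by auto
    qed
    then have "(x, z) \<notin> F" using F by (auto simp: all_pairs_def)
    then obtain j where "j \<in> {1..k}" "(x, z) \<in> all_pairs (T j)"
      using xz unfolding arcs T_def by blast
    then have "j \<in> {1..k}" "x \<in> T j" "z \<in> T j" by (auto simp: all_pairs_def)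
    with T_unique[OF i _ xT] show ?thesis by blast
  qed
  have "2 * card (T ` {1..k}) \<le> rainbow2_domination_number G"
  proof (rule rainbow2_ge_clique_partition[OF P])
    fix C assume "C \<in> T ` {1..k}"
    then obtain i where i: "i \<in> {1..k}" "C = T i" by blast
    show "\<exists>x\<in>C. \<exists>y\<in>C. x \<noteq> y \<and> (\<forall>z. x \<rightarrow> z \<or> y \<rightarrow> z \<longrightarrow> z \<in> C)"
    proof (intro bexI conjI)
      show "w i \<noteq> u i" using dist i by auto
      show "\<forall>z. w i \<rightarrow> z \<or> u i \<rightarrow> z \<longrightarrow> z \<in> C" using inner i by blast
    qed (auto simp: i T_def)
  qed
  with P show ?thesis by (rule extremal_if_clique_partition)
qed

lemma colour_classes_commute: "colour_classes G X Y \<longleftrightarrow> colour_classes G Y X"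
  by (auto simp: colour_classes_def)

text \<open>
  In two triangles with matching edges \<open>a1 b1\<close> and \<open>a2 b2\<close>, suppose that the first triangle carries
  weight 1, namely colour 1 on \<open>a3\<close>. Then \<open>a1\<close> and \<open>a2\<close> can see colour 2 only at \<open>b1\<close> and \<open>b2\<close>,
  so both of these have it; and \<open>b3\<close>, which is either labelled or sees colour 1 at one of them,
  accounts for one more unit of weight in the second triangle.
\<close>

lemma light_triangle_forces_heavy:
  assumes XY: "colour_classes G X Y"
    and dist: "distinct [a1, a2, a3]" "distinct [b1, b2, b3]"
    and V: "{a1, a2, a3} \<union> {b1, b2, b3} \<subseteq> verts G"
    and N: "\<And>z. a1 \<rightarrow> z \<Longrightarrow> z \<in> {a2, a3, b1}" "\<And>z. a2 \<rightarrow> z \<Longrightarrow> z \<in> {a1, a3, b2}"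
      "\<And>z. b3 \<rightarrow> z \<Longrightarrow> z \<in> {b1, b2}"
    and a3: "a3 \<in> X" and light: "card (X \<inter> {a1, a2, a3}) + card (Y \<inter> {a1, a2, a3}) \<le> 1"
  shows "4 \<le> card (X \<inter> {a1, a2, a3}) + card (Y \<inter> {a1, a2, a3})
    + (card (X \<inter> {b1, b2, b3}) + card (Y \<inter> {b1, b2, b3}))"
proof -
  have nb: "\<exists>y\<in>Y. u \<rightarrow> y" "\<exists>x\<in>X. u \<rightarrow> x" if "u \<in> verts G" "u \<notin> X" "u \<notin> Y" for u
    using XY that unfolding colour_classes_def by blast+
  have out: "a1 \<notin> X" "a2 \<notin> X" "a1 \<notin> Y" "a2 \<notin> Y" "a3 \<notin> Y"
    using light a3 dist by (auto simp: Int_insert_right split: if_splits)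
  then have "b1 \<in> Y" "b2 \<in> Y"
    using nb(1)[of a1] nb(1)[of a2] N(1,2) V by auto
  moreover have "b3 \<in> Y \<or> b1 \<in> X \<or> b2 \<in> X \<or> b3 \<in> X"
    using nb(2)[of b3] N(3) V by auto
  ultimately show ?thesis
    using a3 out dist by (auto simp: Int_insert_right)
qed

text \<open>
  The second alternative is needed: with both colours on \<open>b1\<close>, colour 2 on \<open>b2\<close> and colour 1 on
  \<open>a3\<close>, the first triangle has weight 1.
\<close>

lemma matched_triangle_weight:
  assumes XY: "colour_classes G X Y"
    and dist: "distinct [a1, a2, a3]" "distinct [b1, b2, b3]"
    and V: "{a1, a2, a3} \<union> {b1, b2, b3} \<subseteq> verts G"
    and N: "\<And>z. a1 \<rightarrow> z \<Longrightarrow> z \<in> {a2, a3, b1}" "\<And>z. a2 \<rightarrow> z \<Longrightarrow> z \<in> {a1, a3, b2}"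
      "\<And>z. a3 \<rightarrow> z \<Longrightarrow> z \<in> {a1, a2}" "\<And>z. b3 \<rightarrow> z \<Longrightarrow> z \<in> {b1, b2}"
  shows "2 \<le> card (X \<inter> {a1, a2, a3}) + card (Y \<inter> {a1, a2, a3}) \<or>
    4 \<le> card (X \<inter> {a1, a2, a3}) + card (Y \<inter> {a1, a2, a3})
      + (card (X \<inter> {b1, b2, b3}) + card (Y \<inter> {b1, b2, b3}))"
proof (cases "a3 \<in> X \<union> Y")
  case False
  then have "\<exists>x\<in>X. a3 \<rightarrow> x" "\<exists>y\<in>Y. a3 \<rightarrow> y"
    using XY V unfolding colour_classes_def by blast+
  then have "a1 \<in> X \<or> a2 \<in> X" "a1 \<in> Y \<or> a2 \<in> Y" using N(3) by blast+
  then show ?thesis using dist by (auto simp: Int_insert_right)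
next
  case True
  show ?thesis
  proof (cases "2 \<le> card (X \<inter> {a1, a2, a3}) + card (Y \<inter> {a1, a2, a3})")
    case False
    then have light: "card (X \<inter> {a1, a2, a3}) + card (Y \<inter> {a1, a2, a3}) \<le> 1" by linarith
    have YX: "colour_classes G Y X" using XY colour_classes_commute by blast
    from True show ?thesis
    proof
      assume "a3 \<in> X"
      from light_triangle_forces_heavy[OF XY dist V N(1,2,4) this light] show ?thesis by blast
    next
      assume "a3 \<in> Y"
      with light_triangle_forces_heavy[OF YX dist V N(1,2,4)] light show ?thesis by linarith
    qed
  qed simp
qed

text \<open>
  The previous bound, applied from both sides, leaves only total weight at least 4.
\<close>

lemma extremal_if_two_triangles:
  assumes "two_triangles_with_matching G"
  shows "rainbow2_domination_number G = 2 * weak_roman_domination_number G"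
proof -
  obtain A B M where AB: "card A = 3" "card B = 3" "A \<inter> B = {}" "verts G = A \<union> B"
    and M: "M \<subseteq> A \<times> B" "card M = 2" "inj_on fst M" "inj_on snd M"
    and arcs: "arcs_ends G = all_pairs A \<union> all_pairs B \<union> M \<union> M\<inverse>"
    using assms unfolding two_triangles_with_matching_def by blast
  obtain a1 b1 a2 b2 where Meq: "M = {(a1, b1), (a2, b2)}" "(a1, b1) \<noteq> (a2, b2)"
    using M(2) by (auto simp: card_2_iff)
  then have neq: "a1 \<noteq> a2" "b1 \<noteq> b2"
    using M(3,4) by (auto simp: inj_on_def)
  have mem: "a1 \<in> A" "a2 \<in> A" "b1 \<in> B" "b2 \<in> B" using M(1) Meq by auto
  obtain a3 where A: "A = {a1, a2, a3}" "a3 \<noteq> a1" "a3 \<noteq> a2"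
    using third_vertex[OF AB(1) mem(1,2) neq(1)] by blast
  obtain b3 where B: "B = {b1, b2, b3}" "b3 \<noteq> b1" "b3 \<noteq> b2"
    using third_vertex[OF AB(2) mem(3,4) neq(2)] by blast
  have N: "a1 \<rightarrow> z \<Longrightarrow> z \<in> {a2, a3, b1}" "a2 \<rightarrow> z \<Longrightarrow> z \<in> {a1, a3, b2}" "a3 \<rightarrow> z \<Longrightarrow> z \<in> {a1, a2}"
    "b1 \<rightarrow> z \<Longrightarrow> z \<in> {b2, b3, a1}" "b2 \<rightarrow> z \<Longrightarrow> z \<in> {b1, b3, a2}" "b3 \<rightarrow> z \<Longrightarrow> z \<in> {b1, b2}" for z
    using AB(3) neq A(2,3) B(2,3) unfolding arcs Meq A(1) B(1) all_pairs_def by auto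
  have P: "clique_partition G {A, B}"
    using AB arcs mem unfolding clique_partition_def
    by (auto simp: partition_on_def all_pairs_def pairwise_def disjnt_def)
  obtain X Y where XY: "colour_classes G X Y" "rainbow2_domination_number G = card X + card Y"
    by (rule colour_classes_attained)
  have sub: "X \<subseteq> verts G" "Y \<subseteq> verts G"
    using XY by (auto simp: colour_classes_def)
  have "A \<noteq> B" using AB(3) mem by blast
  then have total: "rainbow2_domination_number G =
      card (X \<inter> A) + card (Y \<inter> A) + (card (X \<inter> B) + card (Y \<inter> B))"
    using XY(2) card_eq_sum_blocks[OF P sub(1)] card_eq_sum_blocks[OF P sub(2)] by simp
  have "2 \<le> card (X \<inter> A) + card (Y \<inter> A) \<or> 4 \<le> rainbow2_domination_number G"
    unfolding total A(1) B(1)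
    by (rule matched_triangle_weight[OF XY(1)]) (use A B neq N AB in auto)
  moreover have "2 \<le> card (X \<inter> B) + card (Y \<inter> B) \<or> 4 \<le> rainbow2_domination_number G"
    unfolding total A(1) B(1) add.commute[of "card (X \<inter> {a1, a2, a3}) + card (Y \<inter> {a1, a2, a3})"]
    by (rule matched_triangle_weight[OF XY(1)]) (use A B neq N AB in auto)
  ultimately have "2 * card {A, B} \<le> rainbow2_domination_number G"
    using total \<open>A \<noteq> B\<close> by auto
  with P show ?thesis by (rule extremal_if_clique_partition)
qed

end

theorem corollary2:
  fixes G :: "('a, 'b) pre_digraph"
  assumes "graph G" and "Digraph_Component.connected G" and "K4_diamond_free G"
  shows "rainbow2_domination_number G = 2 * weak_roman_domination_number G \<longleftrightarrow>
    complete_digraph 2 G \<or>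
    two_triangles_with_matching G \<or>
    triangles_joined_at_vertices (weak_roman_domination_number G) G"
proof -
  interpret graph G by fact
  show ?thesis
    using extremal_structure[OF assms(2,3)] extremal_if_K2 extremal_if_two_triangles
      extremal_if_triangles_joined by blast
qed

end
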